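(* Let $G$ be a nilpotent group of bounded period. Then every (not necessarily finite) unimodular system of equations over $G$ is solvable in $G$ itself.
   Context: Equations over groups. Let $G$ be a group and let $X=\{x_j\}_{j\in J}$ be a (possibly infinite) set of variables. Let $F(X)$ be the free group with basis $X$ and $G*F(X)$ the free product. An equation over $G$ is an expression $w=1$ with $w\in G*F(X)$ (each $w$ involves only finitely many variables). A system of equations over $G$ is a (finite or infinite) family $\{w_i=1\}_{i\in I}$ of such equations. The system is solvable in $G$ itself if there are elements $g_j\in G$ $(j\in J)$ such that substituting $g_j$ for $x_j$ makes all $w_i$ equal to $1$ in $G$; equivalently, there is a homomorphism $G*F(X)\to G$ which is the identity on $G$ and sends every $w_i$ to $1$. Exponent sums. For a system $\{w_i=1\}_{i\in I}$ let $a_{ij}\in\mathbb Z$ be the exponent sum of $x_j$ in $w_i$ (for example, the exponent sum of $x$ in $x^{-1}gyx^2g^2x^{-3}y^2$ is $-2$). The row of the $i$-th equation is $(a_{ij})_{j\in J}$; it has finitely many non-zero entries. For a prime $p$, the system is $p$-nonsingular if the family of rows reduced modulo $p$, indexed by $i\in I$, is linearly independent over the field $\mathbb Z_p$ of order $p$ (equivalently, this holds for every finite subsystem). The system is unimodular if it is $p$-nonsingular for every prime $p$. The period of a group is its exponent; a group $G$ has bounded period if there is an integer $n\ge 1$ with $g^n=1$ for all $g\in G$. *)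

theory Defs
  imports "HOL-Algebra.Generated_Groups" "HOL-Number_Theory.Residues"
begin

section \<open>Nilpotent groups and groups of bounded period\<close>

fun lower_central :: "('a, 'b) monoid_scheme \<Rightarrow> nat \<Rightarrow> 'a set" where
  "lower_central G 0 = carrier G"
| "lower_central G (Suc n) =
     generate G {inv\<^bsub>G\<^esub> a \<otimes>\<^bsub>G\<^esub> inv\<^bsub>G\<^esub> b \<otimes>\<^bsub>G\<^esub> a \<otimes>\<^bsub>G\<^esub> b | a b. a \<in> lower_central G n \<and> b \<in> carrier G}"

definition nilpotent_group :: "('a, 'b) monoid_scheme \<Rightarrow> bool" where
  "nilpotent_group G \<longleftrightarrow> group G \<and> (\<exists>n. lower_central G n = {\<one>\<^bsub>G\<^esub>})"

definition bounded_period :: "('a, 'b) monoid_scheme \<Rightarrow> bool" where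
  "bounded_period G \<longleftrightarrow> (\<exists>n::nat. n \<ge> 1 \<and> (\<forall>g\<in>carrier G. g [^]\<^bsub>G\<^esub> n = \<one>\<^bsub>G\<^esub>))"


section \<open>The free product of a group with a free group\<close>

text \<open>
  The free product of \<open>G\<close> with the free group on \<open>X = {x\<^sub>j | j \<in> J}\<close> is the set of words in the
  elements of \<open>G\<close> and the symbols \<open>x\<^sub>j\<close>, \<open>x\<^sub>j\<^sup>-\<^sup>1\<close>, modulo the multiplication table of \<open>G\<close> and free
  cancellation.  That this is the free product is confirmed by \<open>group_free_prod\<close>,
  \<open>coeff_incl_inj\<close>, \<open>free_prod_universal\<close> and \<open>free_prod_hom_unique\<close> below.
\<close>

datatype ('a, 'j) letter = Coeff 'a | Var 'j | InvVar 'j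

type_synonym ('a, 'j) word = "('a, 'j) letter list"

definition words :: "('a, 'b) monoid_scheme \<Rightarrow> 'j set \<Rightarrow> ('a, 'j) word set" where
  "words G J = lists (Coeff ` carrier G \<union> Var ` J \<union> InvVar ` J)"

inductive word_eq :: "('a, 'b) monoid_scheme \<Rightarrow> 'j set \<Rightarrow> ('a, 'j) word \<Rightarrow> ('a, 'j) word \<Rightarrow> bool"
  for G :: "('a, 'b) monoid_scheme" and J :: "'j set" where
  refl: "word_eq G J u u"
| sym: "word_eq G J u v \<Longrightarrow> word_eq G J v u"
| trans: "word_eq G J u v \<Longrightarrow> word_eq G J v w \<Longrightarrow> word_eq G J u w"
| mult: "g \<in> carrier G \<Longrightarrow> h \<in> carrier G \<Longrightarrow>
    word_eq G J (u @ [Coeff g, Coeff h] @ v) (u @ [Coeff (g \<otimes>\<^bsub>G\<^esub> h)] @ v)"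
| one: "word_eq G J (u @ [Coeff \<one>\<^bsub>G\<^esub>] @ v) (u @ v)"
| var_inv: "j \<in> J \<Longrightarrow> word_eq G J (u @ [Var j, InvVar j] @ v) (u @ v)"
| inv_var: "j \<in> J \<Longrightarrow> word_eq G J (u @ [InvVar j, Var j] @ v) (u @ v)"

definition word_rel :: "('a, 'b) monoid_scheme \<Rightarrow> 'j set \<Rightarrow> (('a, 'j) word \<times> ('a, 'j) word) set" where
  "word_rel G J = {(u, v). u \<in> words G J \<and> v \<in> words G J \<and> word_eq G J u v}"

definition word_class :: "('a, 'b) monoid_scheme \<Rightarrow> 'j set \<Rightarrow> ('a, 'j) word \<Rightarrow> ('a, 'j) word set" where
  "word_class G J u = word_rel G J `` {u}"

definition free_prod :: "('a, 'b) monoid_scheme \<Rightarrow> 'j set \<Rightarrow> ('a, 'j) word set monoid" where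
  "free_prod G J = \<lparr>
     carrier = words G J // word_rel G J,
     monoid.mult = (\<lambda>A B. \<Union>u\<in>A. \<Union>v\<in>B. word_class G J (u @ v)),
     one = word_class G J []\<rparr>"

definition coeff_incl :: "('a, 'b) monoid_scheme \<Rightarrow> 'j set \<Rightarrow> 'a \<Rightarrow> ('a, 'j) word set" where
  "coeff_incl G J g = word_class G J [Coeff g]"

definition var_incl :: "('a, 'b) monoid_scheme \<Rightarrow> 'j set \<Rightarrow> 'j \<Rightarrow> ('a, 'j) word set" where
  "var_incl G J j = word_class G J [Var j]"


section \<open>Systems of equations over a group\<close>

text \<open>
  A system \<open>{w\<^sub>i = 1 | i \<in> I}\<close> is the family of its left-hand sides.  The sets \<open>I\<close> and \<open>J\<close> are
  arbitrary.
\<close>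

definition equation_system ::
  "('a, 'b) monoid_scheme \<Rightarrow> 'j set \<Rightarrow> 'i set \<Rightarrow> ('i \<Rightarrow> ('a, 'j) word set) \<Rightarrow> bool" where
  "equation_system G J I w \<longleftrightarrow> (\<forall>i\<in>I. w i \<in> carrier (free_prod G J))"

definition solvable_in_itself ::
  "('a, 'b) monoid_scheme \<Rightarrow> 'j set \<Rightarrow> 'i set \<Rightarrow> ('i \<Rightarrow> ('a, 'j) word set) \<Rightarrow> bool" where
  "solvable_in_itself G J I w \<longleftrightarrow>
     (\<exists>h \<in> hom (free_prod G J) G.
        (\<forall>g\<in>carrier G. h (coeff_incl G J g) = g) \<and> (\<forall>i\<in>I. h (w i) = \<one>\<^bsub>G\<^esub>))"

fun letter_exponent :: "'j \<Rightarrow> ('a, 'j) letter \<Rightarrow> int" where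
  "letter_exponent j (Coeff g) = 0"
| "letter_exponent j (Var k) = (if k = j then 1 else 0)"
| "letter_exponent j (InvVar k) = (if k = j then -1 else 0)"

definition word_exponent_sum :: "'j \<Rightarrow> ('a, 'j) word \<Rightarrow> int" where
  "word_exponent_sum j u = (\<Sum>l\<leftarrow>u. letter_exponent j l)"

text \<open>The choice of the representative is immaterial; see \<open>exponent_sum_word_class\<close>.\<close>

definition exponent_sum :: "'j \<Rightarrow> ('a, 'j) word set \<Rightarrow> int" where
  "exponent_sum j A = word_exponent_sum j (SOME u. u \<in> A)"

text \<open>
  Linear independence over \<open>R\<close> of the family \<open>(v i)\<close>, \<open>i \<in> I\<close>, of vectors with coordinates
  indexed by \<open>J\<close>.
\<close>

definition lin_independent_family ::
  "('r, 'm) ring_scheme \<Rightarrow> 'j set \<Rightarrow> 'i set \<Rightarrow> ('i \<Rightarrow> 'j \<Rightarrow> 'r) \<Rightarrow> bool" where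
  "lin_independent_family R J I v \<longleftrightarrow>
     (\<forall>S c. finite S \<and> S \<subseteq> I \<and> c \<in> S \<rightarrow> carrier R \<and>
        (\<forall>j\<in>J. (\<Oplus>\<^bsub>R\<^esub>i\<in>S. c i \<otimes>\<^bsub>R\<^esub> v i j) = \<zero>\<^bsub>R\<^esub>) \<longrightarrow> (\<forall>i\<in>S. c i = \<zero>\<^bsub>R\<^esub>))"

definition p_nonsingular :: "nat \<Rightarrow> 'j set \<Rightarrow> 'i set \<Rightarrow> ('i \<Rightarrow> ('a, 'j) word set) \<Rightarrow> bool" where
  "p_nonsingular p J I w \<longleftrightarrow>
     lin_independent_family (residue_ring (int p)) J I (\<lambda>i j. exponent_sum j (w i) mod int p)"

definition unimodular :: "'j set \<Rightarrow> 'i set \<Rightarrow> ('i \<Rightarrow> ('a, 'j) word set) \<Rightarrow> bool" where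
  "unimodular J I w \<longleftrightarrow> (\<forall>p. prime p \<longrightarrow> p_nonsingular p J I w)"


section \<open>Basic facts confirming the definitions\<close>

lemma word_eq_append:
  assumes "word_eq G J u v" shows "word_eq G J (a @ u @ b) (a @ v @ b)"
  using assms
proof induction
  case (mult g h u v)
  then show ?case using word_eq.mult[of g G h J "a @ u" "v @ b"] by simp
next
  case (one u v)
  then show ?case using word_eq.one[of G J "a @ u" "v @ b"] by simp
next
  case (var_inv j u v)
  then show ?case using word_eq.var_inv[of j J G "a @ u" "v @ b"] by simp
next
  case (inv_var j u v)
  then show ?case using word_eq.inv_var[of j J G "a @ u" "v @ b"] by simp
qed (blast intro: word_eq.intros)+

lemma word_eq_append2:
  assumes "word_eq G J u u'" "word_eq G J v v'" shows "word_eq G J (u @ v) (u' @ v')"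
  using word_eq_append[OF assms(1), of "[]" v] word_eq_append[OF assms(2), of u' "[]"]
  by (simp add: word_eq.trans[of G J "u @ v" "u' @ v"])

lemma words_Nil [simp]: "[] \<in> words G J"
  and words_append [simp]: "u @ v \<in> words G J \<longleftrightarrow> u \<in> words G J \<and> v \<in> words G J"
  and words_Cons: "l # u \<in> words G J \<longleftrightarrow> [l] \<in> words G J \<and> u \<in> words G J"
  and words_Coeff [simp]: "Coeff g # u \<in> words G J \<longleftrightarrow> g \<in> carrier G \<and> u \<in> words G J"
  and words_Var [simp]: "Var j # u \<in> words G J \<longleftrightarrow> j \<in> J \<and> u \<in> words G J"
  and words_InvVar [simp]: "InvVar j # u \<in> words G J \<longleftrightarrow> j \<in> J \<and> u \<in> words G J"
  by (auto simp: words_def)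

lemma equiv_word_rel: "equiv (words G J) (word_rel G J)"
  by (rule equivI)
     (auto simp: refl_on_def sym_on_def trans_on_def word_rel_def intro: word_eq.refl word_eq.sym elim: word_eq.trans)

lemma word_class_eq_iff:
  assumes "u \<in> words G J" "v \<in> words G J"
  shows "word_class G J u = word_class G J v \<longleftrightarrow> word_eq G J u v"
  using eq_equiv_class_iff[OF equiv_word_rel assms] assms
  by (auto simp: word_class_def word_rel_def)

lemma word_class_in_carrier [simp]: "u \<in> words G J \<Longrightarrow> word_class G J u \<in> carrier (free_prod G J)"
  by (auto simp: free_prod_def word_class_def intro: quotientI)

lemma free_prod_cases:
  assumes "A \<in> carrier (free_prod G J)"
  obtains u where "u \<in> words G J" "A = word_class G J u"
  using assms by (auto simp: free_prod_def word_class_def elim: quotientE)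

lemma word_class_mult:
  assumes "u \<in> words G J" "v \<in> words G J"
  shows "word_class G J u \<otimes>\<^bsub>free_prod G J\<^esub> word_class G J v = word_class G J (u @ v)"
proof -
  have *: "word_class G J (u' @ v') = word_class G J (u @ v)"
    if "u' \<in> word_class G J u" "v' \<in> word_class G J v" for u' v'
  proof -
    have u': "u' \<in> words G J" "word_eq G J u u'" and v': "v' \<in> words G J" "word_eq G J v v'"
      using that by (simp_all add: word_class_def word_rel_def)
    have "word_eq G J (u' @ v') (u @ v)"
      by (rule word_eq.sym[OF word_eq_append2[OF u'(2) v'(2)]])
    then show ?thesis using assms u' v' by (simp add: word_class_eq_iff)
  qed
  have "u \<in> word_class G J u" "v \<in> word_class G J v"
    using assms by (simp_all add: word_class_def word_rel_def word_eq.refl)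
  then have "(\<Union>u'\<in>word_class G J u. \<Union>v'\<in>word_class G J v. word_class G J (u @ v)) = word_class G J (u @ v)"
    by auto
  moreover have "(\<Union>u'\<in>word_class G J u. \<Union>v'\<in>word_class G J v. word_class G J (u' @ v')) =
      (\<Union>u'\<in>word_class G J u. \<Union>v'\<in>word_class G J v. word_class G J (u @ v))"
    by (intro SUP_cong HOL.refl *)
  ultimately show ?thesis
    by (simp add: free_prod_def)
qed

lemma free_prod_one: "\<one>\<^bsub>free_prod G J\<^esub> = word_class G J []"
  by (simp add: free_prod_def)

fun inv_letter :: "('a, 'b) monoid_scheme \<Rightarrow> ('a, 'j) letter \<Rightarrow> ('a, 'j) letter" where
  "inv_letter G (Coeff g) = Coeff (inv\<^bsub>G\<^esub> g)"
| "inv_letter G (Var j) = InvVar j"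
| "inv_letter G (InvVar j) = Var j"

lemma group_free_prod:
  assumes "group G" shows "group (free_prod G J)"
proof (rule groupI)
  interpret group G by fact
  let ?F = "free_prod G J"
  show "A \<otimes>\<^bsub>?F\<^esub> B \<in> carrier ?F" if "A \<in> carrier ?F" "B \<in> carrier ?F" for A B
    using that by (auto elim!: free_prod_cases simp: word_class_mult)
  show "\<one>\<^bsub>?F\<^esub> \<in> carrier ?F"
    by (simp add: free_prod_one)
  show "A \<otimes>\<^bsub>?F\<^esub> B \<otimes>\<^bsub>?F\<^esub> C = A \<otimes>\<^bsub>?F\<^esub> (B \<otimes>\<^bsub>?F\<^esub> C)"
    if "A \<in> carrier ?F" "B \<in> carrier ?F" "C \<in> carrier ?F" for A B C
    using that by (auto elim!: free_prod_cases simp: word_class_mult)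
  show "\<one>\<^bsub>?F\<^esub> \<otimes>\<^bsub>?F\<^esub> A = A" if "A \<in> carrier ?F" for A
    using that by (auto elim!: free_prod_cases simp: word_class_mult free_prod_one)
  have inv: "\<exists>v\<in>words G J. word_eq G J (v @ u) []" if "u \<in> words G J" for u :: "('a, 'c) word"
    using that
  proof (induction u)
    case Nil
    then show ?case using word_eq.refl by force
  next
    case (Cons l u)
    then obtain v where v: "v \<in> words G J" "word_eq G J (v @ u) []"
      using words_Cons by blast
    have l: "[l] \<in> words G J" using Cons words_Cons by blast
    have "word_eq G J ([inv_letter G l] @ [l]) [] \<and> [inv_letter G l] \<in> words G J"
    proof (cases l)
      case (Coeff g)
      with l have g: "g \<in> carrier G" by simp
      then have "word_eq G J [Coeff (inv\<^bsub>G\<^esub> g), Coeff g] [Coeff \<one>\<^bsub>G\<^esub>]"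
        using word_eq.mult[of "inv\<^bsub>G\<^esub> g" G g J "[]" "[]"] by simp
      from word_eq.trans[OF this, of "[]"] g Coeff show ?thesis
        using word_eq.one[of G J "[]" "[]"] by simp
    next
      case (Var j)
      with l show ?thesis using word_eq.inv_var[of j J G "[]" "[]"] by simp
    next
      case (InvVar j)
      with l show ?thesis using word_eq.var_inv[of j J G "[]" "[]"] by simp
    qed
    then have *: "word_eq G J ((v @ [inv_letter G l]) @ l # u) (v @ u)"
      "v @ [inv_letter G l] \<in> words G J"
      using word_eq_append[of G J "[inv_letter G l] @ [l]" "[]" v u] v by auto
    then show ?case using word_eq.trans[OF *(1) v(2)] by blast
  qed
  show "\<exists>B\<in>carrier ?F. B \<otimes>\<^bsub>?F\<^esub> A = \<one>\<^bsub>?F\<^esub>" if A: "A \<in> carrier ?F" for A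
  proof -
    obtain u where u: "u \<in> words G J" "A = word_class G J u"
      using free_prod_cases[OF A] .
    obtain v where "v \<in> words G J" "word_eq G J (v @ u) []"
      using inv[OF u(1)] by blast
    then show ?thesis using u
      by (intro bexI[of _ "word_class G J v"]) (auto simp: word_class_mult free_prod_one word_class_eq_iff)
  qed
qed

lemma coeff_incl_hom:
  assumes "group G" shows "coeff_incl G J \<in> hom G (free_prod G J)"
proof (rule homI)
  interpret group G by fact
  fix g h assume gh: "g \<in> carrier G" "h \<in> carrier G"
  have "word_eq G J ([Coeff g] @ [Coeff h]) [Coeff (g \<otimes>\<^bsub>G\<^esub> h)]"
    using word_eq.mult[OF gh, of J "[]" "[]"] by simp
  with gh show "coeff_incl G J (g \<otimes>\<^bsub>G\<^esub> h) = coeff_incl G J g \<otimes>\<^bsub>free_prod G J\<^esub> coeff_incl G J h"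
    unfolding coeff_incl_def by (subst word_class_mult) (auto simp: word_class_eq_iff intro: word_eq.sym)
qed (simp add: coeff_incl_def)

lemma var_incl_in_carrier: "j \<in> J \<Longrightarrow> var_incl G J j \<in> carrier (free_prod G J)"
  by (simp add: var_incl_def)

text \<open>Evaluation of words under a homomorphism on coefficients and a substitution.\<close>

fun eval_letter :: "('c, 'd) monoid_scheme \<Rightarrow> ('a \<Rightarrow> 'c) \<Rightarrow> ('j \<Rightarrow> 'c) \<Rightarrow> ('a, 'j) letter \<Rightarrow> 'c" where
  "eval_letter H f s (Coeff g) = f g"
| "eval_letter H f s (Var j) = s j"
| "eval_letter H f s (InvVar j) = inv\<^bsub>H\<^esub> s j"

definition eval_word :: "('c, 'd) monoid_scheme \<Rightarrow> ('a \<Rightarrow> 'c) \<Rightarrow> ('j \<Rightarrow> 'c) \<Rightarrow> ('a, 'j) word \<Rightarrow> 'c" where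
  "eval_word H f s u = foldr (\<lambda>l x. eval_letter H f s l \<otimes>\<^bsub>H\<^esub> x) u \<one>\<^bsub>H\<^esub>"

lemma eval_word_simps [simp]:
  "eval_word H f s [] = \<one>\<^bsub>H\<^esub>"
  "eval_word H f s (l # u) = eval_letter H f s l \<otimes>\<^bsub>H\<^esub> eval_word H f s u"
  by (simp_all add: eval_word_def)

context
  fixes G :: "('a, 'b) monoid_scheme" and H :: "('c, 'd) monoid_scheme"
    and J :: "'j set" and f :: "'a \<Rightarrow> 'c" and s :: "'j \<Rightarrow> 'c"
  assumes G: "group G" and H: "group H" and f: "f \<in> hom G H" and s: "s \<in> J \<rightarrow> carrier H"
begin

interpretation G: group G by (rule G)
interpretation H: group H by (rule H)

lemma eval_letter_closed: "[l] \<in> words G J \<Longrightarrow> eval_letter H f s l \<in> carrier H"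
  using f s by (cases l) (auto simp: hom_def)

lemma eval_word_closed: "u \<in> words G J \<Longrightarrow> eval_word H f s u \<in> carrier H"
proof (induction u)
  case (Cons l u)
  then show ?case using words_Cons[of l u G J] eval_letter_closed[of l] by simp
qed simp

lemma eval_word_append:
  "u \<in> words G J \<Longrightarrow> v \<in> words G J \<Longrightarrow>
    eval_word H f s (u @ v) = eval_word H f s u \<otimes>\<^bsub>H\<^esub> eval_word H f s v"
proof (induction u)
  case (Cons l u)
  then show ?case
    using words_Cons[of l u G J] eval_letter_closed[of l] eval_word_closed H.m_assoc by simp
qed (simp add: eval_word_closed)

lemma eval_word_middle:
  assumes "a \<in> words G J" "a' \<in> words G J" "u \<in> words G J" "v \<in> words G J"
    "eval_word H f s a = eval_word H f s a'"
  shows "eval_word H f s (u @ a @ v) = eval_word H f s (u @ a' @ v)"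
  using assms by (simp add: eval_word_append)

lemma eval_word_cong_aux:
  assumes "word_eq G J u v"
  shows "(u \<in> words G J \<longleftrightarrow> v \<in> words G J) \<and>
    (u \<in> words G J \<longrightarrow> eval_word H f s u = eval_word H f s v)"
  using assms
proof induction
  case (mult g h u v)
  have "f (g \<otimes>\<^bsub>G\<^esub> h) = f g \<otimes>\<^bsub>H\<^esub> f h" "f g \<in> carrier H" "f h \<in> carrier H"
    using f mult by (auto simp: hom_def)
  then show ?case
    using mult eval_word_middle[of "[Coeff g, Coeff h]" "[Coeff (g \<otimes>\<^bsub>G\<^esub> h)]" u v] by auto
next
  case (one u v)
  have "f \<one>\<^bsub>G\<^esub> = \<one>\<^bsub>H\<^esub>" using f G H by (rule hom_one)
  then show ?case
    using eval_word_middle[of "[Coeff \<one>\<^bsub>G\<^esub>]" "[]" u v] by auto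
next
  case (var_inv j u v)
  then have "s j \<in> carrier H" using s by auto
  with var_inv show ?case
    using eval_word_middle[of "[Var j, InvVar j]" "[]" u v] by auto
next
  case (inv_var j u v)
  then have "s j \<in> carrier H" using s by auto
  with inv_var show ?case
    using eval_word_middle[of "[InvVar j, Var j]" "[]" u v] by auto
qed auto

lemma eval_word_cong:
  "word_eq G J u v \<Longrightarrow> u \<in> words G J \<Longrightarrow> eval_word H f s u = eval_word H f s v"
  using eval_word_cong_aux by blast

lemma eval_hom_exists:
  "\<exists>h \<in> hom (free_prod G J) H. \<forall>u\<in>words G J. h (word_class G J u) = eval_word H f s u"
proof -
  define h where "h A = eval_word H f s (SOME u. u \<in> A)" for A :: "('a, 'j) word set"
  have h: "h (word_class G J u) = eval_word H f s u" if "u \<in> words G J" for u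
  proof -
    have "u \<in> word_class G J u"
      using that by (simp add: word_class_def word_rel_def word_eq.refl)
    then have "(SOME v. v \<in> word_class G J u) \<in> word_class G J u" by (rule someI)
    then show ?thesis
      using that eval_word_cong[of u "SOME v. v \<in> word_class G J u"]
      by (simp add: h_def word_class_def word_rel_def)
  qed
  then have "h \<in> hom (free_prod G J) H"
    by (intro homI) (auto elim!: free_prod_cases simp: word_class_mult eval_word_append eval_word_closed)
  with h show ?thesis by blast
qed

theorem free_prod_universal:
  "\<exists>h \<in> hom (free_prod G J) H. (\<forall>g\<in>carrier G. h (coeff_incl G J g) = f g) \<and> (\<forall>j\<in>J. h (var_incl G J j) = s j)"
proof -
  obtain h where h: "h \<in> hom (free_prod G J) H"
    "\<And>u. u \<in> words G J \<Longrightarrow> h (word_class G J u) = eval_word H f s u"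
    using eval_hom_exists by blast
  moreover have "f g \<in> carrier H" if "g \<in> carrier G" for g using f that by (auto simp: hom_def)
  moreover have "s j \<in> carrier H" if "j \<in> J" for j using s that by auto
  ultimately show ?thesis by (auto simp: coeff_incl_def var_incl_def intro!: bexI[of _ h])
qed

lemma free_prod_hom_eval:
  assumes h: "h \<in> hom (free_prod G J) H" "\<forall>g\<in>carrier G. h (coeff_incl G J g) = f g"
    "\<forall>j\<in>J. h (var_incl G J j) = s j" and u: "u \<in> words G J"
  shows "h (word_class G J u) = eval_word H f s u"
  using u
proof (induction u)
  case Nil
  then show ?case
    using hom_one[OF h(1) group_free_prod[OF G] H] by (simp add: free_prod_one)
next
  case (Cons l u)
  then have lu: "[l] \<in> words G J" "u \<in> words G J" using words_Cons by blast+
  have "h (word_class G J [l]) = eval_letter H f s l"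
  proof (cases l)
    case (Coeff g) with lu h(2) show ?thesis by (simp add: coeff_incl_def)
  next
    case (Var j) with lu h(3) show ?thesis by (simp add: var_incl_def)
  next
    case (InvVar j)
    with lu have j: "j \<in> J" by simp
    have "word_class G J [InvVar j] \<otimes>\<^bsub>free_prod G J\<^esub> var_incl G J j = \<one>\<^bsub>free_prod G J\<^esub>"
      using j word_eq.inv_var[OF j, of G "[]" "[]"]
      by (simp add: var_incl_def word_class_mult free_prod_one word_class_eq_iff)
    then have "h (word_class G J [InvVar j]) \<otimes>\<^bsub>H\<^esub> h (var_incl G J j) = \<one>\<^bsub>H\<^esub>"
      using hom_mult[OF h(1), of "word_class G J [InvVar j]" "var_incl G J j"] j
        hom_one[OF h(1) group_free_prod[OF G] H] by (simp add: var_incl_in_carrier)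
    moreover have "h (word_class G J [InvVar j]) \<in> carrier H" "s j \<in> carrier H"
      using h(1) j s by (auto simp: hom_def)
    ultimately show ?thesis using InvVar j h(3) H.inv_equality by simp
  qed
  moreover have "h (word_class G J (l # u)) = h (word_class G J [l]) \<otimes>\<^bsub>H\<^esub> h (word_class G J u)"
    using hom_mult[OF h(1), of "word_class G J [l]" "word_class G J u"] lu
    by (simp add: word_class_mult)
  ultimately show ?case using Cons.IH lu by simp
qed

theorem free_prod_hom_unique:
  assumes "h \<in> hom (free_prod G J) H" "\<forall>g\<in>carrier G. h (coeff_incl G J g) = f g" "\<forall>j\<in>J. h (var_incl G J j) = s j"
    and "h' \<in> hom (free_prod G J) H" "\<forall>g\<in>carrier G. h' (coeff_incl G J g) = f g" "\<forall>j\<in>J. h' (var_incl G J j) = s j"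
    and "A \<in> carrier (free_prod G J)"
  shows "h A = h' A"
  using assms free_prod_hom_eval by (metis free_prod_cases)

end

theorem coeff_incl_inj:
  assumes "group G" shows "inj_on (coeff_incl G J) (carrier G)"
proof -
  interpret group G by fact
  obtain h where "\<forall>g\<in>carrier G. h (coeff_incl G J g) = g"
    using free_prod_universal[OF assms assms, of "\<lambda>g. g" "\<lambda>j. \<one>\<^bsub>G\<^esub>" J] by (auto simp: hom_def)
  then show ?thesis by (intro inj_on_inverseI[of _ h]) simp
qed

text \<open>Solvability in terms of substituting elements of \<open>G\<close> into words representing the equations.\<close>

theorem solvable_in_itself_iff:
  assumes "group G" "\<And>i. i \<in> I \<Longrightarrow> u i \<in> words G J"
  shows "solvable_in_itself G J I (\<lambda>i. word_class G J (u i)) \<longleftrightarrow>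
    (\<exists>s \<in> J \<rightarrow> carrier G. \<forall>i\<in>I. eval_word G (\<lambda>g. g) s (u i) = \<one>\<^bsub>G\<^esub>)"
proof
  assume "solvable_in_itself G J I (\<lambda>i. word_class G J (u i))"
  then obtain h where h: "h \<in> hom (free_prod G J) G" "\<forall>g\<in>carrier G. h (coeff_incl G J g) = g"
    "\<forall>i\<in>I. h (word_class G J (u i)) = \<one>\<^bsub>G\<^esub>"
    by (auto simp: solvable_in_itself_def)
  have s: "(\<lambda>j. h (var_incl G J j)) \<in> J \<rightarrow> carrier G"
    using h(1) var_incl_in_carrier[of _ J G] by (auto simp: hom_def)
  have "h (word_class G J (u i)) = eval_word G (\<lambda>g. g) (\<lambda>j. h (var_incl G J j)) (u i)" if "i \<in> I" for i
    using free_prod_hom_eval[OF assms(1) assms(1) _ s h(1,2) _ assms(2)[OF that]] by (simp add: hom_def)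
  with s h(3) show "\<exists>s \<in> J \<rightarrow> carrier G. \<forall>i\<in>I. eval_word G (\<lambda>g. g) s (u i) = \<one>\<^bsub>G\<^esub>"
    by (intro bexI[of _ "\<lambda>j. h (var_incl G J j)"]) auto
next
  interpret group G by fact
  assume "\<exists>s \<in> J \<rightarrow> carrier G. \<forall>i\<in>I. eval_word G (\<lambda>g. g) s (u i) = \<one>\<^bsub>G\<^esub>"
  then obtain s where s: "s \<in> J \<rightarrow> carrier G" "\<forall>i\<in>I. eval_word G (\<lambda>g. g) s (u i) = \<one>\<^bsub>G\<^esub>"
    by blast
  obtain h where "h \<in> hom (free_prod G J) G"
    "\<And>u. u \<in> words G J \<Longrightarrow> h (word_class G J u) = eval_word G (\<lambda>g. g) s u"
    using eval_hom_exists[OF assms(1) assms(1) _ s(1), of "\<lambda>g. g"] by (auto simp: hom_def)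
  with s(2) assms(2) show "solvable_in_itself G J I (\<lambda>i. word_class G J (u i))"
    unfolding solvable_in_itself_def by (auto simp: coeff_incl_def intro!: bexI[of _ h])
qed

lemma word_exponent_sum_cong:
  "word_eq G J u v \<Longrightarrow> word_exponent_sum j u = word_exponent_sum j v"
  by (induction rule: word_eq.induct) (auto simp: word_exponent_sum_def)

theorem exponent_sum_word_class:
  assumes "u \<in> words G J"
  shows "exponent_sum j (word_class G J u) = word_exponent_sum j u"
proof -
  have "u \<in> word_class G J u"
    using assms by (simp add: word_class_def word_rel_def word_eq.refl)
  then have "(SOME v. v \<in> word_class G J u) \<in> word_class G J u" by (rule someI)
  then have "word_eq G J u (SOME v. v \<in> word_class G J u)"
    unfolding word_class_def word_rel_def by blast
  from word_exponent_sum_cong[OF this, of j] show ?thesis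
    by (simp add: exponent_sum_def)
qed

theorem p_nonsingular_iff_cong:
  assumes "prime p"
  shows "p_nonsingular p J I w \<longleftrightarrow>
    (\<forall>S c. finite S \<and> S \<subseteq> I \<and> (\<forall>j\<in>J. [(\<Sum>i\<in>S. c i * exponent_sum j (w i)) = 0] (mod int p)) \<longrightarrow>
       (\<forall>i\<in>S. [c i = 0] (mod int p)))" (is "_ \<longleftrightarrow> ?R")
proof -
  define R where "R = residue_ring (int p)"
  interpret residues_prime p R
    by unfold_locales (simp_all add: assms R_def)
  have sum: "(\<Oplus>\<^bsub>R\<^esub>i\<in>S. (c i mod int p) \<otimes>\<^bsub>R\<^esub> (exponent_sum j (w i) mod int p)) =
      (\<Sum>i\<in>S. c i * exponent_sum j (w i)) mod int p" if "finite S" for S c j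
    using sum_cong[OF that, of "\<lambda>i. c i * exponent_sum j (w i)"] by (simp add: mult_cong)
  show ?thesis
  proof
    assume L: "p_nonsingular p J I w"
    show ?R
    proof (intro allI impI)
      fix S c
      assume *: "finite S \<and> S \<subseteq> I \<and> (\<forall>j\<in>J. [(\<Sum>i\<in>S. c i * exponent_sum j (w i)) = 0] (mod int p))"
      then have "\<forall>j\<in>J. (\<Oplus>\<^bsub>R\<^esub>i\<in>S. (c i mod int p) \<otimes>\<^bsub>R\<^esub> (exponent_sum j (w i) mod int p)) = \<zero>\<^bsub>R\<^esub>"
        using sum[of S c] by (auto simp: cong_def zero_cong)
      moreover have "(\<lambda>i. c i mod int p) \<in> S \<rightarrow> carrier R" by auto
      ultimately have "\<forall>i\<in>S. c i mod int p = \<zero>\<^bsub>R\<^esub>"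
        using L[unfolded p_nonsingular_def lin_independent_family_def, folded R_def, rule_format,
            of S "\<lambda>i. c i mod int p"] * by blast
      then show "\<forall>i\<in>S. [c i = 0] (mod int p)" by (simp add: cong_def zero_cong)
    qed
  next
    assume ?R
    show "p_nonsingular p J I w"
      unfolding p_nonsingular_def lin_independent_family_def R_def[symmetric]
    proof (intro allI impI, elim conjE)
      fix S c
      assume S: "finite S" "S \<subseteq> I" and c: "c \<in> S \<rightarrow> carrier R"
        and z: "\<forall>j\<in>J. (\<Oplus>\<^bsub>R\<^esub>i\<in>S. c i \<otimes>\<^bsub>R\<^esub> (exponent_sum j (w i) mod int p)) = \<zero>\<^bsub>R\<^esub>"
      have cm: "c i mod int p = c i" if "i \<in> S" for i
      proof -
        have "c i \<in> {0..int p - 1}" using c that by (auto simp: res_carrier_eq)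
        then show ?thesis by simp
      qed
      have "(\<Oplus>\<^bsub>R\<^esub>i\<in>S. (c i mod int p) \<otimes>\<^bsub>R\<^esub> (exponent_sum j (w i) mod int p)) =
        (\<Oplus>\<^bsub>R\<^esub>i\<in>S. c i \<otimes>\<^bsub>R\<^esub> (exponent_sum j (w i) mod int p))" for j
        using c by (intro finsum_cong') (auto simp: cm)
      with z sum[OF S(1), of c]
      have "\<forall>j\<in>J. [(\<Sum>i\<in>S. c i * exponent_sum j (w i)) = 0] (mod int p)"
        by (simp add: cong_def zero_cong)
      with \<open>?R\<close> S have "\<forall>i\<in>S. [c i = 0] (mod int p)" by blast
      with cm show "\<forall>i\<in>S. c i = \<zero>\<^bsub>R\<^esub>" by (simp add: cong_def zero_cong)
    qed
  qed
qed

end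

theory Submission
  imports Defs
begin

text \<open>
  The system is solved modulo the successive terms \<open>\<gamma>\<^sub>k\<close> of the lower central series
  (\<open>solve_modulo_lower_central\<close>).  Suppose that a substitution \<open>s\<close> sends every \<open>w\<^sub>i\<close> to some
  \<open>b\<^sub>i \<in> \<gamma>\<^sub>k\<close>.  In \<open>G / \<gamma>\<^sub>k\<^sub>+\<^sub>1\<close> the \<open>b\<^sub>i\<close> are central, and multiplying each \<open>s\<^sub>j\<close> by a central
  element \<open>z\<^sub>j\<close> multiplies the value of \<open>w\<^sub>i\<close> by \<open>\<Prod>\<^sub>j z\<^sub>j\<^bsup>a\<^sub>i\<^sub>j\<^esup>\<close>, where \<open>a\<^sub>i\<^sub>j\<close> is the exponent sum
  (\<open>eval_word_central_perturbation\<close>).  Hence only the linear system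
  \<open>\<Prod>\<^sub>j z\<^sub>j\<^bsup>a\<^sub>i\<^sub>j\<^esup> = b\<^sub>i\<^sup>-\<^sup>1\<close> over an abelian group of period \<open>n\<close> has to be solved.

  That linear system has a solution that is uniform in the right-hand sides.  If \<open>C\<close> is an
  integer matrix, indexed by \<open>J \<times> I\<close> and with finite rows, such that \<open>A C \<equiv> 1\<close> modulo \<open>n\<close>,
  then \<open>z\<^sub>j = \<Prod>\<^sub>k b\<^sub>k\<^bsup>-C\<^sub>j\<^sub>k\<^esup>\<close> works.  For \<open>n\<close> a prime \<open>p\<close>, such a \<open>C\<close> exists because the rows of
  \<open>A\<close> are independent modulo \<open>p\<close> (\<open>right_inverse_mod_prime\<close>): by Zorn's lemma, as many columns
  as possible are deleted while the rows stay independent, and then the rows have become a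
  basis of the space spanned by the remaining unit vectors, so that \<open>C\<close> is read off from the
  expansions of these unit vectors.  The identity
  \<open>1 - A E = (1 - A C) (1 - A D)\<close> for \<open>E = C + D - C A D\<close> turns right inverses modulo \<open>m\<close> and
  \<open>n\<close> into one modulo \<open>m n\<close> (\<open>right_inverse_mod_mult\<close>), so that unimodularity gives right
  inverses for all \<open>n \<ge> 1\<close>.  Each row of \<open>C\<close> being finite, infinite systems need no separate
  treatment.
\<close>

section \<open>Right inverses of integer matrices modulo \<open>n\<close>\<close>

text \<open>
  The rows \<open>a i\<close>, \<open>i \<in> I\<close>, remain linearly independent modulo \<open>p\<close> when the columns in \<open>K\<close>
  are deleted.  Equivalently, the rows together with the unit vectors \<open>e\<^sub>j\<close>, \<open>j \<in> K\<close>, are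
  independent; deleting columns avoids an index set that joins \<open>I\<close> and \<open>K\<close>.
\<close>

definition independent_off :: "nat \<Rightarrow> 'i set \<Rightarrow> ('i \<Rightarrow> 'j \<Rightarrow> int) \<Rightarrow> 'j set \<Rightarrow> bool" where
  "independent_off p I a K \<longleftrightarrow>
     (\<forall>S c. finite S \<and> S \<subseteq> I \<and> (\<forall>j. j \<notin> K \<longrightarrow> int p dvd (\<Sum>i\<in>S. c i * a i j)) \<longrightarrow>
        (\<forall>i\<in>S. int p dvd c i))"

text \<open>
  The congruence \<open>A C \<equiv> 1\<close> of matrices, where \<open>A\<close> has the rows \<open>a i\<close>, \<open>i \<in> I\<close>, and the rows
  of \<open>C\<close> are finite combinations of unit vectors.  The sum runs over the support of \<open>a i\<close>, so
  that infinitely many columns are harmless as long as each row of \<open>A\<close> is finite.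
\<close>

definition right_inverse_mod ::
  "nat \<Rightarrow> 'i set \<Rightarrow> ('i \<Rightarrow> 'j \<Rightarrow> int) \<Rightarrow> ('j \<Rightarrow> 'i \<Rightarrow> int) \<Rightarrow> bool" where
  "right_inverse_mod n I a C \<longleftrightarrow>
     (\<forall>j. finite {k. C j k \<noteq> 0} \<and> {k. C j k \<noteq> 0} \<subseteq> I) \<and>
     (\<forall>i\<in>I. \<forall>k. int n dvd of_bool (i = k) - (\<Sum>j | a i j \<noteq> 0. a i j * C j k))"

text \<open>
  Deleting columns as long as the rows stay independent is possible in Zorn's sense because a
  dependence involves finitely many rows, each of them with finitely many non-zero entries.
\<close>

lemma maximal_independent_off:
  assumes fin: "\<And>i. i \<in> I \<Longrightarrow> finite {j. a i j \<noteq> 0}"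
    and indep: "independent_off p I a {}"
  obtains K where "independent_off p I a K"
    and "\<And>j. j \<notin> K \<Longrightarrow> \<not> independent_off p I a (insert j K)"
proof -
  have "\<exists>K\<in>Collect (independent_off p I a).
      \<forall>X\<in>Collect (independent_off p I a). K \<subseteq> X \<longrightarrow> X = K"
  proof (rule subset_Zorn_nonempty)
    show "Collect (independent_off p I a) \<noteq> {}"
      using indep by blast
    fix \<C>
    assume ne: "\<C> \<noteq> {}" and chain: "subset.chain (Collect (independent_off p I a)) \<C>"
    have "int p dvd c i"
      if S: "finite S" "S \<subseteq> I" and c: "\<And>j. j \<notin> \<Union>\<C> \<Longrightarrow> int p dvd (\<Sum>i\<in>S. c i * a i j)" and "i \<in> S"
      for S c i
    proof -
      \<comment> \<open>The relation involves finitely many columns, so one member of the chain covers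
        all of them that are deleted at all.\<close>
      let ?D = "(\<Union>i\<in>S. {j. a i j \<noteq> 0}) \<inter> \<Union>\<C>"
      have "finite ?D" using S fin by auto
      then obtain B where B: "B \<in> \<C>" "?D \<subseteq> B"
        using finite_subset_Union_chain[of ?D \<C>] ne chain by blast
      have "int p dvd (\<Sum>i\<in>S. c i * a i j)" if "j \<notin> B" for j
      proof (cases "j \<in> \<Union>\<C>")
        case True
        then have "\<forall>i\<in>S. a i j = 0" using B that by auto
        then show ?thesis by (simp add: sum.neutral)
      qed (rule c)
      moreover have "independent_off p I a B"
        using B chain by (auto simp: subset.chain_def)
      ultimately show ?thesis
        using S \<open>i \<in> S\<close> unfolding independent_off_def by blast
    qed
    then show "\<Union>\<C> \<in> Collect (independent_off p I a)"
      unfolding independent_off_def by blast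
  qed
  then obtain K where "independent_off p I a K"
    and "\<And>X. independent_off p I a X \<Longrightarrow> K \<subseteq> X \<Longrightarrow> X = K"
    by auto
  then show thesis using that by blast
qed

text \<open>
  Let \<open>K\<close> be a maximal set of deletable columns.  By maximality, deleting a further column
  \<open>j\<close> creates a dependence among the rows; it does not vanish in column \<open>j\<close>, so a multiple of
  it expresses the unit vector \<open>e\<^sub>j\<close>, away from \<open>K\<close>, by the rows.  The coefficients form the row
  \<open>C\<^sub>j\<close>, and \<open>C\<^sub>j = 0\<close> for \<open>j \<in> K\<close>.  Thus \<open>C A \<equiv> 1\<close> outside \<open>K\<close>, whence
  \<open>(1 - A C) A \<equiv> 0\<close> there, and the independence of the rows yields \<open>A C \<equiv> 1\<close>.
\<close>

lemma right_inverse_mod_prime: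
  assumes p: "prime p"
    and fin: "\<And>i. i \<in> I \<Longrightarrow> finite {j. a i j \<noteq> 0}"
    and indep: "independent_off p I a {}"
  shows "\<exists>C. right_inverse_mod p I a C"
proof -
  obtain K where K: "independent_off p I a K"
    and max: "\<And>j. j \<notin> K \<Longrightarrow> \<not> independent_off p I a (insert j K)"
    using maximal_independent_off[OF fin indep] by blast
  define good where "good j c \<longleftrightarrow> finite {i. c i \<noteq> 0} \<and> {i. c i \<noteq> 0} \<subseteq> I \<and> (j \<in> K \<longrightarrow> c = (\<lambda>_. 0)) \<and>
      (j \<notin> K \<longrightarrow> (\<forall>l. l \<notin> K \<longrightarrow> int p dvd of_bool (l = j) - (\<Sum>i | c i \<noteq> 0. c i * a i l)))"
    for j c
  have "\<exists>c. good j c" for j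
  proof (cases "j \<in> K")
    case False
    then obtain S c i where S: "finite S" "S \<subseteq> I" "i \<in> S" "\<not> int p dvd c i"
      and c: "\<forall>l. l \<notin> insert j K \<longrightarrow> int p dvd (\<Sum>i\<in>S. c i * a i l)"
      using max[of j] unfolding independent_off_def by auto
    have "\<not> int p dvd (\<Sum>i\<in>S. c i * a i j)"
    proof
      assume "int p dvd (\<Sum>i\<in>S. c i * a i j)"
      then have "int p dvd (\<Sum>i\<in>S. c i * a i l)" if "l \<notin> K" for l
        using c that by (cases "l = j") auto
      then show False using K S unfolding independent_off_def by blast
    qed
    then have "coprime (\<Sum>i\<in>S. c i * a i j) (int p)"
      using p by (simp add: coprime_commute prime_imp_coprime)
    then obtain e where "[(\<Sum>i\<in>S. c i * a i j) * e = 1] (mod int p)"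
      using cong_solve_coprime_int by blast
    then have e: "int p dvd 1 - (\<Sum>i\<in>S. c i * a i j) * e"
      by (simp add: cong_iff_dvd_diff dvd_diff_commute)
    define d where "d i = (if i \<in> S then c i * e else 0)" for i
    have d: "(\<Sum>i | d i \<noteq> 0. d i * a i l) = (\<Sum>i\<in>S. c i * a i l) * e" for l
    proof -
      have "(\<Sum>i | d i \<noteq> 0. d i * a i l) = (\<Sum>i\<in>S. d i * a i l)"
        by (rule sum.mono_neutral_left) (auto simp: S d_def split: if_splits)
      then show ?thesis by (simp add: d_def sum_distrib_left mult_ac)
    qed
    have "{i. d i \<noteq> 0} \<subseteq> S" by (auto simp: d_def)
    with S have "finite {i. d i \<noteq> 0}" "{i. d i \<noteq> 0} \<subseteq> I" by (auto intro: finite_subset)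
    moreover have "int p dvd of_bool (l = j) - (\<Sum>i | d i \<noteq> 0. d i * a i l)" if "l \<notin> K" for l
      using c e that by (cases "l = j") (auto simp: d)
    ultimately have "good j d" using False by (simp add: good_def)
    then show ?thesis by blast
  qed (auto simp: good_def intro!: exI[of _ "\<lambda>_. 0"])
  then obtain C where "\<And>j. good j (C j)" by metis
  then have finC: "finite {i. C j i \<noteq> 0}" and subC: "{i. C j i \<noteq> 0} \<subseteq> I"
    and C0: "j \<in> K \<Longrightarrow> C j = (\<lambda>_. 0)"
    and C1: "j \<notin> K \<Longrightarrow> l \<notin> K \<Longrightarrow>
      int p dvd of_bool (l = j) - (\<Sum>i | C j i \<noteq> 0. C j i * a i l)"
    for j l
    unfolding good_def by simp_all
  have "int p dvd of_bool (i = k) - (\<Sum>j | a i j \<noteq> 0. a i j * C j k)" if i: "i \<in> I" for i k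
  proof (cases "k \<in> I")
    case False
    then have "C j k = 0" for j using subC[of j] by blast
    moreover have "i \<noteq> k" using False i by blast
    ultimately show ?thesis by simp
  next
    case True
    let ?T = "{j. a i j \<noteq> 0}"
    \<comment> \<open>\<open>d\<close> is row \<open>i\<close> of \<open>1 - A C\<close>, supported in \<open>S\<close>.\<close>
    define S where "S = insert i (insert k (\<Union>j\<in>?T. {h. C j h \<noteq> 0}))"
    define d where "d h = of_bool (i = h) - (\<Sum>j\<in>?T. a i j * C j h)" for h
    have S: "finite S" "S \<subseteq> I"
      using fin[OF i] finC subC i True by (auto simp: S_def)
    have row: "(\<Sum>h\<in>S. C j h * a h l) = (\<Sum>h | C j h \<noteq> 0. C j h * a h l)" if "j \<in> ?T" for j l
      by (rule sum.mono_neutral_right) (use S that in \<open>auto simp: S_def\<close>)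
    have "int p dvd (\<Sum>h\<in>S. d h * a h l)" if l: "l \<notin> K" for l
    proof -
      have "(\<Sum>h\<in>S. d h * a h l) = a i l - (\<Sum>h\<in>S. \<Sum>j\<in>?T. a i j * C j h * a h l)"
        using S by (simp add: d_def left_diff_distrib sum_subtractf sum_distrib_right S_def)
      also have "(\<Sum>h\<in>S. \<Sum>j\<in>?T. a i j * C j h * a h l) = (\<Sum>j\<in>?T. \<Sum>h\<in>S. a i j * C j h * a h l)"
        by (rule sum.swap)
      also have "\<dots> = (\<Sum>j\<in>?T. a i j * (\<Sum>h | C j h \<noteq> 0. C j h * a h l))"
        by (rule sum.cong) (simp_all add: row[symmetric] sum_distrib_left mult.assoc)
      also have "a i l = (\<Sum>j\<in>?T. a i j * of_bool (l = j))"
        using fin[OF i] by (simp add: of_bool_def if_distrib cong: if_cong)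
      finally have eq: "(\<Sum>h\<in>S. d h * a h l) =
          (\<Sum>j\<in>?T. a i j * (of_bool (l = j) - (\<Sum>h | C j h \<noteq> 0. C j h * a h l)))"
        by (simp add: right_diff_distrib sum_subtractf)
      have "int p dvd of_bool (l = j) - (\<Sum>h | C j h \<noteq> 0. C j h * a h l)" for j
        using C0[of j] C1[of j l] l by (cases "j \<in> K") auto
      then show ?thesis unfolding eq by (intro dvd_sum dvd_mult)
    qed
    with K S have "\<forall>h\<in>S. int p dvd d h"
      unfolding independent_off_def by blast
    then have "int p dvd d k" by (simp add: S_def)
    then show ?thesis by (simp add: d_def)
  qed
  with finC subC show ?thesis
    unfolding right_inverse_mod_def by blast
qed

text \<open>
  With \<open>P = A C\<close> and \<open>Q = A D\<close>, the matrix \<open>E = C + D - C Q\<close> satisfies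
  \<open>1 - A E = (1 - P) (1 - Q)\<close>; the first factor is divisible by \<open>m\<close>, the second by \<open>n\<close>.
\<close>

lemma right_inverse_mod_mult:
  assumes fin: "\<And>i. i \<in> I \<Longrightarrow> finite {j. a i j \<noteq> 0}"
    and C: "right_inverse_mod m I a C" and D: "right_inverse_mod n I a D"
  shows "\<exists>E. right_inverse_mod (m * n) I a E"
proof -
  have finC: "finite {k. C j k \<noteq> 0}" and subC: "{k. C j k \<noteq> 0} \<subseteq> I"
    and finD: "finite {k. D j k \<noteq> 0}" and subD: "{k. D j k \<noteq> 0} \<subseteq> I" for j
    using C D by (auto simp: right_inverse_mod_def)
  define P where "P i k = (\<Sum>j | a i j \<noteq> 0. a i j * C j k)" for i k
  define Q where "Q i k = (\<Sum>j | a i j \<noteq> 0. a i j * D j k)" for i k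
  define E where "E j k = C j k + D j k - (\<Sum>h | C j h \<noteq> 0. C j h * Q h k)" for j k
  have P: "int m dvd of_bool (i = k) - P i k" if "i \<in> I" for i k
    using C that by (simp add: right_inverse_mod_def P_def)
  have Q: "int n dvd of_bool (i = k) - Q i k" if "i \<in> I" for i k
    using D that by (simp add: right_inverse_mod_def Q_def)
  let ?B = "\<lambda>j. {k. C j k \<noteq> 0} \<union> {k. D j k \<noteq> 0} \<union>
    (\<Union>h\<in>{h. C j h \<noteq> 0}. \<Union>l\<in>{l. a h l \<noteq> 0}. {k. D l k \<noteq> 0})"
  have "E j k = 0" if "k \<notin> ?B j" for j k
  proof -
    have "Q h k = 0" if "C j h \<noteq> 0" for h
      unfolding Q_def using \<open>k \<notin> ?B j\<close> that by (intro sum.neutral) auto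
    then have "(\<Sum>h | C j h \<noteq> 0. C j h * Q h k) = 0" by (intro sum.neutral) auto
    with that show ?thesis by (simp add: E_def)
  qed
  then have supp: "{k. E j k \<noteq> 0} \<subseteq> ?B j" for j by blast
  have "finite (?B j)" for j
    using finC finD fin subC by (intro finite_UnI finite_UN_I) blast+
  moreover have "?B j \<subseteq> I" for j
    using subC subD by blast
  ultimately have E: "finite {k. E j k \<noteq> 0}" "{k. E j k \<noteq> 0} \<subseteq> I" for j
    using supp[of j] by (blast intro: finite_subset)+
  have "int (m * n) dvd of_bool (i = k) - (\<Sum>j | a i j \<noteq> 0. a i j * E j k)" if i: "i \<in> I" for i k
  proof (cases "k \<in> I")
    case False
    then have "E j k = 0" for j using E(2)[of j] by blast
    moreover have "i \<noteq> k" using False i by blast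
    ultimately show ?thesis by simp
  next
    case True
    let ?T = "{j. a i j \<noteq> 0}"
    define S where "S = insert i (insert k (\<Union>j\<in>?T. {h. C j h \<noteq> 0}))"
    have S: "finite S" "S \<subseteq> I"
      using fin[OF i] finC subC i True by (auto simp: S_def)
    have row: "(\<Sum>h | C j h \<noteq> 0. C j h * Q h k) = (\<Sum>h\<in>S. C j h * Q h k)" if "j \<in> ?T" for j
      by (rule sum.mono_neutral_left) (use S that in \<open>auto simp: S_def\<close>)
    have "(\<Sum>j\<in>?T. a i j * (\<Sum>h | C j h \<noteq> 0. C j h * Q h k)) = (\<Sum>j\<in>?T. \<Sum>h\<in>S. a i j * C j h * Q h k)"
      by (rule sum.cong) (simp_all add: row sum_distrib_left mult.assoc)
    also have "\<dots> = (\<Sum>h\<in>S. P i h * Q h k)"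
      by (subst sum.swap) (simp add: P_def sum_distrib_right)
    finally have "(\<Sum>j\<in>?T. a i j * E j k) = P i k + Q i k - (\<Sum>h\<in>S. P i h * Q h k)"
      by (simp add: E_def P_def Q_def algebra_simps sum.distrib sum_subtractf)
    moreover have "(\<Sum>h\<in>S. (of_bool (i = h) - P i h) * (of_bool (h = k) - Q h k)) =
        (\<Sum>h\<in>S. of_bool (i = h) * of_bool (h = k)) - (\<Sum>h\<in>S. of_bool (i = h) * Q h k)
        - (\<Sum>h\<in>S. P i h * of_bool (h = k)) + (\<Sum>h\<in>S. P i h * Q h k)"
      by (simp only: sum.distrib[symmetric] sum_subtractf[symmetric])
         (simp add: algebra_simps)
    moreover have "(\<Sum>h\<in>S. of_bool (i = h) * of_bool (h = k)) = (of_bool (i = k) :: int)"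
      "(\<Sum>h\<in>S. of_bool (i = h) * Q h k) = Q i k" "(\<Sum>h\<in>S. P i h * of_bool (h = k)) = P i k"
      using S by (simp_all add: S_def)
    ultimately have "of_bool (i = k) - (\<Sum>j\<in>?T. a i j * E j k) =
        (\<Sum>h\<in>S. (of_bool (i = h) - P i h) * (of_bool (h = k) - Q h k))"
      by linarith
    moreover have "int (m * n) dvd (\<Sum>h\<in>S. (of_bool (i = h) - P i h) * (of_bool (h = k) - Q h k))"
      unfolding of_nat_mult by (intro dvd_sum mult_dvd_mono P Q) (use i S in auto)
    ultimately show ?thesis by simp
  qed
  with E show ?thesis unfolding right_inverse_mod_def by blast
qed

lemma right_inverse_mod_exists:
  assumes fin: "\<And>i. i \<in> I \<Longrightarrow> finite {j. a i j \<noteq> 0}"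
    and indep: "\<And>p. prime p \<Longrightarrow> independent_off p I a {}"
    and n: "n \<noteq> 0"
  shows "\<exists>C. right_inverse_mod n I a C"
  using n
proof (induction n rule: prime_divisors_induct)
  case (unit n)
  then have "right_inverse_mod n I a (\<lambda>_ _. 0)" by (simp add: right_inverse_mod_def)
  then show ?case by blast
next
  case (factor p n)
  then obtain C where C: "right_inverse_mod n I a C" by auto
  obtain D where "right_inverse_mod p I a D"
    using right_inverse_mod_prime[OF factor(1) fin indep] factor(1) by blast
  from right_inverse_mod_mult[OF fin this C] show ?case by simp
qed simp

section \<open>The lower central series\<close>

lemma lower_central_normal:
  fixes G (structure)
  assumes "group G" shows "lower_central G n \<lhd> G"
proof (induction n)
  interpret group G by fact
  case 0
  show ?case by (simp add: normal_invI subgroup_self)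
next
  interpret group G by fact
  case (Suc n)
  then interpret N: normal "lower_central G n" G .
  show ?case unfolding lower_central.simps
  proof (rule normal_generateI)
    fix h g assume g: "g \<in> carrier G"
      and "h \<in> {inv a \<otimes> inv b \<otimes> a \<otimes> b | a b. a \<in> lower_central G n \<and> b \<in> carrier G}"
    then obtain a b where a: "a \<in> lower_central G n" and b: "b \<in> carrier G"
      and h: "h = inv a \<otimes> inv b \<otimes> a \<otimes> b"
      by blast
    \<comment> \<open>A conjugate of a commutator is the commutator of the conjugates.\<close>
    let ?a = "g \<otimes> a \<otimes> inv g" and ?b = "g \<otimes> b \<otimes> inv g"
    have "inv ?a \<otimes> inv ?b \<otimes> ?a \<otimes> ?b = g \<otimes> h \<otimes> inv g"
      using g b N.mem_carrier[OF a] unfolding h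
      by (simp add: inv_mult_group m_assoc inv_solve_left')
    moreover have "?a \<in> lower_central G n" "?b \<in> carrier G"
      using N.inv_op_closed2[OF g a] b g by auto
    ultimately show "g \<otimes> h \<otimes> inv g \<in>
        {inv a \<otimes> inv b \<otimes> a \<otimes> b | a b. a \<in> lower_central G n \<and> b \<in> carrier G}"
      unfolding mem_Collect_eq by metis
  next
    show "{inv a \<otimes> inv b \<otimes> a \<otimes> b | a b. a \<in> lower_central G n \<and> b \<in> carrier G} \<subseteq> carrier G"
      using N.mem_carrier by (intro subsetI, elim CollectE exE conjE) simp
  qed
qed

lemma lower_central_commutes_mod:
  fixes G (structure)
  assumes "group G" and a: "a \<in> lower_central G n" and b: "b \<in> carrier G"
  defines "N \<equiv> lower_central G (Suc n)"
  shows "(N #>\<^bsub>G\<^esub> a) \<otimes>\<^bsub>G Mod N\<^esub> (N #>\<^bsub>G\<^esub> b) = (N #>\<^bsub>G\<^esub> b) \<otimes>\<^bsub>G Mod N\<^esub> (N #>\<^bsub>G\<^esub> a)"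
proof -
  interpret group G by fact
  interpret N: normal N G unfolding N_def by (rule lower_central_normal) fact
  have aG: "a \<in> carrier G"
    using normal_imp_subgroup[OF lower_central_normal[OF \<open>group G\<close>]] a by (rule subgroup.mem_carrier)
  let ?c = "inv a \<otimes> inv b \<otimes> a \<otimes> b"
  have c: "?c \<in> N"
    unfolding N_def lower_central.simps using a b by (intro generate.incl) blast
  have "x \<otimes> (inv x \<otimes> y) = y" if "x \<in> carrier G" "y \<in> carrier G" for x y
    using that by (simp flip: m_assoc)
  then have "a \<otimes> b = b \<otimes> a \<otimes> ?c"
    using aG b by (simp add: m_assoc)
  then have "N #> (a \<otimes> b) = (N #> (b \<otimes> a)) <#> (N #> ?c)"
    using aG b by (simp add: N.rcos_sum)
  also have "N #> ?c = N"
    using c N.rcos_const by blast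
  also have "(N #> (b \<otimes> a)) <#> N = N #> (b \<otimes> a)"
    using monoid.r_one[OF group.is_monoid[OF N.factorgroup_is_group], of "N #> (b \<otimes> a)"] aG b
    by (simp add: carrier_FactGroup)
  finally show ?thesis using aG b by (simp add: N.rcos_sum)
qed

section \<open>Perturbing a substitution by central elements\<close>

lemma eval_word_hom:
  assumes "group G" "group H" and f: "f \<in> hom G H" and s: "s \<in> J \<rightarrow> carrier G"
    and u: "u \<in> words G J"
  shows "eval_word H f (\<lambda>j. f (s j)) u = f (eval_word G (\<lambda>g. g) s u)"
proof -
  interpret f: group_hom G H f
    using assms by (simp add: group_hom_def group_hom_axioms_def)
  have id: "(\<lambda>g. g) \<in> hom G G" by (simp add: hom_def)
  note closed = eval_letter_closed[OF \<open>group G\<close> \<open>group G\<close> id s]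
    eval_word_closed[OF \<open>group G\<close> \<open>group G\<close> id s]
  show ?thesis using u
  proof (induction u)
    case (Cons l u)
    then have lu: "[l] \<in> words G J" "u \<in> words G J" using words_Cons by blast+
    have "eval_letter H f (\<lambda>j. f (s j)) l = f (eval_letter G (\<lambda>g. g) s l)"
      using lu s by (cases l) (auto simp: Pi_iff)
    with Cons.IH lu closed show ?case by simp
  qed simp
qed

lemma eval_word_subst_cong:
  assumes "u \<in> words G J" and "\<And>j. j \<in> J \<Longrightarrow> s j = t j"
  shows "eval_word H f s u = eval_word H f t u"
  using assms(1)
proof (induction u)
  case (Cons l u)
  then have "[l] \<in> words G J" "u \<in> words G J" using words_Cons by blast+
  with Cons.IH assms(2) show ?case by (cases l) auto
qed simp

fun letter_var :: "('a, 'j) letter \<Rightarrow> 'j set" where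
  "letter_var (Coeff g) = {}"
| "letter_var (Var j) = {j}"
| "letter_var (InvVar j) = {j}"

definition word_vars :: "('a, 'j) word \<Rightarrow> 'j set" where
  "word_vars u = (\<Union>l\<in>set u. letter_var l)"

lemma finite_word_vars:
  fixes u :: "('a, 'j) word" shows "finite (word_vars u)"
proof -
  have "finite (letter_var l)" for l :: "('a, 'j) letter" by (cases l) auto
  then show ?thesis unfolding word_vars_def by blast
qed

lemma word_vars_subset: "u \<in> words G J \<Longrightarrow> word_vars u \<subseteq> J"
  by (induction u) (auto simp: word_vars_def words_def)

lemma word_exponent_sum_notin_vars:
  "j \<notin> word_vars u \<Longrightarrow> word_exponent_sum j u = 0"
proof (induction u)
  case (Cons l u)
  then show ?case by (cases l) (auto simp: word_vars_def word_exponent_sum_def)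
qed (simp add: word_exponent_sum_def)

lemma word_exponent_sum_support:
  "{j. word_exponent_sum j u \<noteq> 0} \<subseteq> word_vars u"
  using word_exponent_sum_notin_vars[of _ u] by auto

definition group_center :: "('a, 'b) monoid_scheme \<Rightarrow> 'a set" where
  "group_center G = {z \<in> carrier G. \<forall>x\<in>carrier G. z \<otimes>\<^bsub>G\<^esub> x = x \<otimes>\<^bsub>G\<^esub> z}"

lemma subgroup_center:
  fixes G (structure)
  assumes "group G" shows "subgroup (group_center G) G"
proof -
  interpret group G by fact
  show ?thesis
  proof (rule subgroupI)
    fix z assume z: "z \<in> group_center G"
    then have zG: "z \<in> carrier G" by (simp add: group_center_def)
    have "inv z \<otimes> x = x \<otimes> inv z" if x: "x \<in> carrier G" for x
    proof -
      have "z \<otimes> inv x = inv x \<otimes> z" using z x by (simp add: group_center_def)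
      then have "inv (z \<otimes> inv x) = inv (inv x \<otimes> z)" by simp
      then show ?thesis using zG x by (simp add: inv_mult_group)
    qed
    then show "inv z \<in> group_center G" using zG by (simp add: group_center_def)
  next
    fix y z assume "y \<in> group_center G" "z \<in> group_center G"
    then have y: "y \<in> carrier G" "\<And>x. x \<in> carrier G \<Longrightarrow> y \<otimes> x = x \<otimes> y"
      and z: "z \<in> carrier G" "\<And>x. x \<in> carrier G \<Longrightarrow> z \<otimes> x = x \<otimes> z"
      by (auto simp: group_center_def)
    have "y \<otimes> z \<otimes> x = x \<otimes> (y \<otimes> z)" if x: "x \<in> carrier G" for x
    proof -
      have "y \<otimes> z \<otimes> x = y \<otimes> x \<otimes> z" using x y(1) z by (simp add: m_assoc)
      then show ?thesis using x y z(1) by (simp add: m_assoc)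
    qed
    then show "y \<otimes> z \<in> group_center G" using y(1) z(1) by (simp add: group_center_def)
  next
    have "\<one> \<in> group_center G" by (simp add: group_center_def)
    then show "group_center G \<noteq> {}" by blast
  next
    show "group_center G \<subseteq> carrier G" unfolding group_center_def by blast
  qed
qed

lemma comm_group_center:
  assumes "group G" shows "comm_group (G\<lparr>carrier := group_center G\<rparr>)"
proof -
  interpret group "G\<lparr>carrier := group_center G\<rparr>"
    by (rule group.subgroup_imp_group[OF assms subgroup_center[OF assms]])
  have "x \<otimes>\<^bsub>G\<^esub> y = y \<otimes>\<^bsub>G\<^esub> x" if "x \<in> group_center G" "y \<in> group_center G" for x y
    using that unfolding group_center_def by blast
  then show ?thesis by (intro group_comm_groupI) simp
qed

text \<open>
  Central factors can be moved out of a word and collected, each with its exponent sum.  They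
  are given through a homomorphism \<open>\<psi>\<close> from integer vectors to the centre, in the application
  \<open>\<psi> x = \<Prod>\<^sub>k \<beta>\<^sub>k\<^bsup>x\<^sub>k\<^esup>\<close> over a finite set of indices \<open>k\<close>; so the collection is integer linear
  algebra in the exponent vectors.
\<close>

lemma eval_word_central_perturbation:
  fixes z :: "'j \<Rightarrow> 'c" and \<psi> :: "('k \<Rightarrow> int) \<Rightarrow> 'c"
  assumes G: "group G" and H: "group H" and f: "f \<in> hom G H" and s: "s \<in> J \<rightarrow> carrier H"
    and \<psi>: "\<And>x. \<psi> x \<in> group_center H"
    and add: "\<And>x y. \<psi> (\<lambda>k. x k + y k) = \<psi> x \<otimes>\<^bsub>H\<^esub> \<psi> y"
    and z: "\<And>j. j \<in> T \<Longrightarrow> z j = \<psi> (C j)"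
    and u: "u \<in> words G J" "word_vars u \<subseteq> T" and T: "finite T"
  shows "eval_word H f (\<lambda>j. s j \<otimes>\<^bsub>H\<^esub> z j) u =
    eval_word H f s u \<otimes>\<^bsub>H\<^esub> \<psi> (\<lambda>k. \<Sum>j\<in>T. word_exponent_sum j u * C j k)"
proof -
  interpret H: group H by fact
  note closed = eval_letter_closed[OF G H f s] eval_word_closed[OF G H f s]
  have \<psi>H [simp]: "\<psi> x \<in> carrier H" for x using \<psi>[of x] by (simp add: group_center_def)
  have comm: "\<psi> x \<otimes>\<^bsub>H\<^esub> h = h \<otimes>\<^bsub>H\<^esub> \<psi> x" if "h \<in> carrier H" for x h
    using \<psi>[of x] that by (simp add: group_center_def)
  have zero: "\<psi> (\<lambda>_. 0) = \<one>\<^bsub>H\<^esub>"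
    using add[of "\<lambda>_. 0" "\<lambda>_. 0"] by (simp add: H.l_cancel_one')
  have minus: "\<psi> (\<lambda>k. - x k) = inv\<^bsub>H\<^esub> \<psi> x" for x
    using add[of "\<lambda>k. - x k" x] by (simp add: zero H.inv_equality)
  show ?thesis using u
  proof (induction u)
    case Nil
    then show ?case by (simp add: word_exponent_sum_def zero)
  next
    case (Cons l u)
    then have lu: "[l] \<in> words G J" "u \<in> words G J" "letter_var l \<subseteq> T" "word_vars u \<subseteq> T"
      using words_Cons by (blast, blast, auto simp: word_vars_def)
    let ?e = "\<lambda>k. \<Sum>j\<in>T. letter_exponent j l * C j k"
    let ?x = "\<lambda>k. \<Sum>j\<in>T. word_exponent_sum j u * C j k"
    have l: "eval_letter H f (\<lambda>j. s j \<otimes>\<^bsub>H\<^esub> z j) l = eval_letter H f s l \<otimes>\<^bsub>H\<^esub> \<psi> ?e"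
    proof (cases l)
      case (Coeff g)
      then have "f g \<in> carrier H" using lu f by (auto simp: hom_def)
      with Coeff show ?thesis by (simp add: zero)
    next
      case (Var j)
      then have "?e = C j"
        using T lu by (auto simp: if_distrib[of "\<lambda>x. x * _"] cong: if_cong)
      with Var lu z show ?thesis by simp
    next
      case (InvVar j)
      then have "?e = (\<lambda>k. - C j k)"
        using T lu by (auto simp: if_distrib[of "\<lambda>x. x * _"] cong: if_cong)
      moreover have "j \<in> T" "s j \<in> carrier H" using InvVar lu s by auto
      ultimately show ?thesis
        using InvVar z comm by (simp add: minus[symmetric] H.inv_mult_group)
    qed
    have ex: "(\<lambda>k. \<Sum>j\<in>T. word_exponent_sum j (l # u) * C j k) = (\<lambda>k. ?e k + ?x k)"
      by (simp add: word_exponent_sum_def algebra_simps sum.distrib)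
    have "eval_word H f (\<lambda>j. s j \<otimes>\<^bsub>H\<^esub> z j) (l # u) =
        (eval_letter H f s l \<otimes>\<^bsub>H\<^esub> \<psi> ?e) \<otimes>\<^bsub>H\<^esub> (eval_word H f s u \<otimes>\<^bsub>H\<^esub> \<psi> ?x)"
      using Cons.IH lu l by simp
    also have "\<dots> = eval_letter H f s l \<otimes>\<^bsub>H\<^esub> (\<psi> ?e \<otimes>\<^bsub>H\<^esub> eval_word H f s u) \<otimes>\<^bsub>H\<^esub> \<psi> ?x"
      using closed lu by (simp add: H.m_assoc)
    also have "\<dots> = eval_word H f s (l # u) \<otimes>\<^bsub>H\<^esub> (\<psi> ?e \<otimes>\<^bsub>H\<^esub> \<psi> ?x)"
      unfolding comm[OF closed(2)[OF lu(2)]]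
      using closed lu by (simp add: H.m_assoc)
    finally show ?case by (simp only: ex add)
  qed
qed

text \<open>
  The correcting factors are \<open>z\<^sub>j = \<Prod>\<^sub>k \<beta>\<^sub>k\<^bsup>C\<^sub>j\<^sub>k\<^esup>\<close>, where \<open>\<beta>\<^sub>k\<close> is the inverse of the \<open>k\<close>-th value.
  They contribute \<open>\<Prod>\<^sub>k \<beta>\<^sub>k\<^bsup>(A C)\<^sub>i\<^sub>k\<^esup> = \<beta>\<^sub>i\<close> to the \<open>i\<close>-th equation, since the \<open>\<beta>\<^sub>k\<close> have period
  \<open>n\<close> and \<open>A C \<equiv> 1\<close> modulo \<open>n\<close>.
\<close>

lemma central_values_correctable:
  assumes G: "group G" and H: "group H" and f: "f \<in> hom G H" and s: "s \<in> J \<rightarrow> carrier H"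
    and u: "\<And>i. i \<in> I \<Longrightarrow> u i \<in> words G J"
    and central: "\<And>i. i \<in> I \<Longrightarrow> eval_word H f s (u i) \<in> group_center H"
    and period: "\<And>i. i \<in> I \<Longrightarrow> eval_word H f s (u i) [^]\<^bsub>H\<^esub> n = \<one>\<^bsub>H\<^esub>"
    and C: "right_inverse_mod n I (\<lambda>i j. word_exponent_sum j (u i)) C"
  shows "\<exists>t \<in> J \<rightarrow> carrier H. \<forall>i\<in>I. eval_word H f t (u i) = \<one>\<^bsub>H\<^esub>"
proof -
  interpret H: group H by fact
  let ?A = "H\<lparr>carrier := group_center H\<rparr>"
  interpret A: comm_group ?A by (rule comm_group_center[OF H])
  have sub: "subgroup (group_center H) H" by (rule subgroup_center[OF H])
  have finC: "finite {k. C j k \<noteq> 0}" and subC: "{k. C j k \<noteq> 0} \<subseteq> I" for j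
    using C by (auto simp: right_inverse_mod_def)
  define \<beta> where "\<beta> k = inv\<^bsub>H\<^esub> eval_word H f s (u k)" for k
  have \<beta>: "\<beta> k \<in> group_center H" if "k \<in> I" for k
    unfolding \<beta>_def using subgroup.m_inv_closed[OF sub] central that by blast
  have \<beta>n: "\<beta> k [^]\<^bsub>?A\<^esub> (int n * m) = \<one>\<^bsub>H\<^esub>" if "k \<in> I" for k m
  proof -
    have "eval_word H f s (u k) \<in> carrier H"
      using central[OF that] by (simp add: group_center_def)
    then have "\<beta> k [^]\<^bsub>H\<^esub> n = \<one>\<^bsub>H\<^esub>"
      using period[OF that] by (simp add: \<beta>_def H.nat_pow_inv)
    then have "\<beta> k [^]\<^bsub>?A\<^esub> n = \<one>\<^bsub>?A\<^esub>"
      by (simp add: nat_pow_def)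
    then have "(\<beta> k [^]\<^bsub>?A\<^esub> int n) [^]\<^bsub>?A\<^esub> m = \<one>\<^bsub>?A\<^esub>"
      using A.int_pow_one[of m] by (simp add: int_pow_int)
    then show ?thesis using A.int_pow_pow[of "\<beta> k" "int n" m] A.int_pow_one[of m] \<beta>[OF that] by simp
  qed
  define z where "z j = finprod ?A (\<lambda>k. \<beta> k [^]\<^bsub>?A\<^esub> C j k) {k. C j k \<noteq> 0}" for j
  have "z j \<in> carrier ?A" for j
    unfolding z_def by (rule A.finprod_closed) (use \<beta> subC A.int_pow_closed in fastforce)
  then have zH: "z j \<in> carrier H" for j
    by (simp add: group_center_def)
  have "eval_word H f (\<lambda>j. s j \<otimes>\<^bsub>H\<^esub> z j) (u i) = \<one>\<^bsub>H\<^esub>" if i: "i \<in> I" for i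
  proof -
    let ?T = "word_vars (u i)"
    \<comment> \<open>For one equation, finitely many \<open>z\<^sub>j\<close> and hence finitely many \<open>\<beta>\<^sub>k\<close> matter; over this
      common finite set \<open>K\<close>, the product \<open>\<psi>\<close> is additive in the exponents.\<close>
    define K where "K = insert i (\<Union>j\<in>?T. {k. C j k \<noteq> 0})"
    have K: "finite K" "K \<subseteq> I"
      using finC subC i by (auto simp: K_def finite_word_vars)
    define \<psi> where "\<psi> x = finprod ?A (\<lambda>k. \<beta> k [^]\<^bsub>?A\<^esub> (x k :: int)) K" for x
    have \<beta>K: "\<beta> k \<in> group_center H" if "k \<in> K" for k
      using \<beta> K that by blast
    have one: "\<one>\<^bsub>H\<^esub> \<in> group_center H"
      by (rule subgroup.one_closed[OF sub])
    have pow': "\<beta> k [^]\<^bsub>?A\<^esub> (x k :: int) \<in> carrier ?A" if "k \<in> K" for x k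
    proof -
      have "\<beta> k \<in> carrier ?A" using \<beta> K that by auto
      then show ?thesis by (rule A.int_pow_closed)
    qed
    then have pow: "(\<lambda>k. \<beta> k [^]\<^bsub>?A\<^esub> (x k :: int)) \<in> K \<rightarrow> carrier ?A" for x
      by blast
    have \<psi>: "\<psi> x \<in> group_center H" for x
      using A.finprod_closed[OF pow] by (simp add: \<psi>_def)
    have add: "\<psi> (\<lambda>k. x k + y k) = \<psi> x \<otimes>\<^bsub>H\<^esub> \<psi> y" for x y
    proof -
      have "\<psi> (\<lambda>k. x k + y k) =
          finprod ?A (\<lambda>k. \<beta> k [^]\<^bsub>?A\<^esub> x k \<otimes>\<^bsub>?A\<^esub> \<beta> k [^]\<^bsub>?A\<^esub> y k) K"
        unfolding \<psi>_def
      proof (rule A.finprod_cong')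
        show "(\<lambda>k. \<beta> k [^]\<^bsub>?A\<^esub> x k \<otimes>\<^bsub>?A\<^esub> \<beta> k [^]\<^bsub>?A\<^esub> y k) \<in> K \<rightarrow> carrier ?A"
          by (intro Pi_I A.m_closed pow')
        fix k assume "k \<in> K"
        then have "\<beta> k \<in> carrier ?A" using \<beta> K by auto
        then show "\<beta> k [^]\<^bsub>?A\<^esub> (x k + y k) = \<beta> k [^]\<^bsub>?A\<^esub> x k \<otimes>\<^bsub>?A\<^esub> \<beta> k [^]\<^bsub>?A\<^esub> y k"
          by (rule A.int_pow_mult)
      qed simp
      also have "\<dots> = \<psi> x \<otimes>\<^bsub>?A\<^esub> \<psi> y"
        unfolding \<psi>_def by (rule A.finprod_multf[OF pow pow])
      finally show ?thesis by simp
    qed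
    have z: "z j = \<psi> (C j)" if "j \<in> ?T" for j
      unfolding z_def \<psi>_def
      by (rule A.finprod_mono_neutral_cong_left) (use K pow that in \<open>auto simp: K_def\<close>)
    let ?x = "\<lambda>k. \<Sum>j\<in>?T. word_exponent_sum j (u i) * C j k"
    have "\<beta> k [^]\<^bsub>?A\<^esub> ?x k = (if i = k then \<beta> k else \<one>\<^bsub>?A\<^esub>)" if k: "k \<in> K" for k
    proof -
      have "?x k = (\<Sum>j | word_exponent_sum j (u i) \<noteq> 0. word_exponent_sum j (u i) * C j k)"
        by (rule sum.mono_neutral_right)
           (auto simp: finite_word_vars word_exponent_sum_support)
      then have "int n dvd of_bool (i = k) - ?x k"
        using C i by (simp add: right_inverse_mod_def)
      then obtain m where "of_bool (i = k) - ?x k = int n * m" by (rule dvdE)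
      then have x: "?x k = of_bool (i = k) + int n * (- m)" by simp
      have "\<beta> k \<in> carrier ?A" using \<beta> k K by auto
      then have "\<beta> k [^]\<^bsub>?A\<^esub> ?x k =
          \<beta> k [^]\<^bsub>?A\<^esub> (of_bool (i = k) :: int) \<otimes>\<^bsub>?A\<^esub> \<beta> k [^]\<^bsub>?A\<^esub> (int n * (- m))"
        unfolding x by (rule A.int_pow_mult)
      also have "\<beta> k [^]\<^bsub>?A\<^esub> (int n * (- m)) = \<one>\<^bsub>?A\<^esub>"
        using \<beta>n[of k "- m"] k K by auto
      finally show ?thesis
        using \<open>\<beta> k \<in> carrier ?A\<close> A.int_pow_1[of "\<beta> k"] by (auto simp: group_center_def)
    qed
    then have "\<psi> ?x = finprod ?A (\<lambda>k. if i = k then \<beta> k else \<one>\<^bsub>?A\<^esub>) K"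
      unfolding \<psi>_def by (intro A.finprod_cong') (use \<beta>K one in auto)
    also have "\<dots> = \<beta> i"
      by (rule A.finprod_singleton) (use \<beta>K K in \<open>auto simp: K_def\<close>)
    finally have "\<psi> ?x = \<beta> i" .
    then have "eval_word H f (\<lambda>j. s j \<otimes>\<^bsub>H\<^esub> z j) (u i) = eval_word H f s (u i) \<otimes>\<^bsub>H\<^esub> \<beta> i"
      using eval_word_central_perturbation[where \<psi> = \<psi>, OF G H f s \<psi> add z u[OF i] order_refl finite_word_vars]
      by simp
    also have "\<dots> = \<one>\<^bsub>H\<^esub>"
      using central[OF i] by (simp add: \<beta>_def group_center_def)
    finally show ?thesis .
  qed
  moreover have "(\<lambda>j. s j \<otimes>\<^bsub>H\<^esub> z j) \<in> J \<rightarrow> carrier H" using s zH by auto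
  ultimately show ?thesis by blast
qed

section \<open>Solving the system along the lower central series\<close>

text \<open>
  The values of a solution modulo \<open>\<gamma>\<^sub>k\<close> are central in \<open>G / \<gamma>\<^sub>k\<^sub>+\<^sub>1\<close>, so they can be
  corrected there.  The corrected substitution may be lifted to \<open>G\<close> arbitrarily, because a value
  that is trivial in the quotient lies in \<open>\<gamma>\<^sub>k\<^sub>+\<^sub>1\<close>.
\<close>

lemma solve_modulo_lower_central:
  fixes G (structure)
  assumes G: "group G" and period: "\<And>g. g \<in> carrier G \<Longrightarrow> g [^]\<^bsub>G\<^esub> (n::nat) = \<one>\<^bsub>G\<^esub>"
    and u: "\<And>i. i \<in> I \<Longrightarrow> u i \<in> words G J"
    and C: "right_inverse_mod n I (\<lambda>i j. word_exponent_sum j (u i)) C"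
  shows "\<exists>s \<in> J \<rightarrow> carrier G. \<forall>i\<in>I. eval_word G (\<lambda>g. g) s (u i) \<in> lower_central G k"
proof (induction k)
  interpret group G by fact
  case 0
  have triv: "(\<lambda>_. \<one>) \<in> J \<rightarrow> carrier G" by simp
  have id: "(\<lambda>g. g) \<in> hom G G" by (simp add: hom_def)
  show ?case
    using eval_word_closed[OF G G id triv u] by (intro bexI[OF _ triv]) simp
next
  interpret group G by fact
  case (Suc k)
  then obtain s where s: "s \<in> J \<rightarrow> carrier G"
    and su: "\<And>i. i \<in> I \<Longrightarrow> eval_word G (\<lambda>g. g) s (u i) \<in> lower_central G k"
    by blast
  define N where "N = lower_central G (Suc k)"
  interpret N: normal N G unfolding N_def by (rule lower_central_normal[OF G])
  define Q where "Q = G Mod N"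
  define \<phi> where "\<phi> g = N #> g" for g
  have Q: "group Q" unfolding Q_def by (rule N.factorgroup_is_group)
  have \<phi>: "\<phi> \<in> hom G Q" unfolding Q_def \<phi>_def by (rule N.r_coset_hom_Mod)
  interpret \<phi>: group_hom G Q \<phi>
    using G Q \<phi> by (simp add: group_hom_def group_hom_axioms_def)
  have onto: "carrier Q = \<phi> ` carrier G" by (simp add: Q_def \<phi>_def carrier_FactGroup)
  have id: "(\<lambda>g. g) \<in> hom G G" by (simp add: hom_def)
  note eval = eval_word_hom[OF G Q \<phi>]
  have "\<exists>t \<in> J \<rightarrow> carrier Q. \<forall>i\<in>I. eval_word Q \<phi> t (u i) = \<one>\<^bsub>Q\<^esub>"
  proof (rule central_values_correctable[OF G Q \<phi> _ u _ _ C])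
    show "(\<lambda>j. \<phi> (s j)) \<in> J \<rightarrow> carrier Q" using s by (simp add: Pi_iff)
    fix i assume i: "i \<in> I"
    have e: "eval_word G (\<lambda>g. g) s (u i) \<in> carrier G"
      by (rule eval_word_closed[OF G G id s u[OF i]])
    show "eval_word Q \<phi> (\<lambda>j. \<phi> (s j)) (u i) \<in> group_center Q"
      unfolding eval[OF s u[OF i]] group_center_def onto
      using lower_central_commutes_mod[OF G su[OF i]] e
      by (auto simp: Q_def \<phi>_def N_def)
    show "eval_word Q \<phi> (\<lambda>j. \<phi> (s j)) (u i) [^]\<^bsub>Q\<^esub> n = \<one>\<^bsub>Q\<^esub>"
      unfolding eval[OF s u[OF i]] using period[OF e] e by (simp flip: \<phi>.hom_nat_pow)
  qed
  then obtain t where t: "t \<in> J \<rightarrow> \<phi> ` carrier G" "\<And>i. i \<in> I \<Longrightarrow> eval_word Q \<phi> t (u i) = \<one>\<^bsub>Q\<^esub>"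
    unfolding onto by blast
  have "\<forall>j\<in>J. \<exists>g\<in>carrier G. \<phi> g = t j" using t(1) by force
  then obtain r where r: "\<And>j. j \<in> J \<Longrightarrow> r j \<in> carrier G" "\<And>j. j \<in> J \<Longrightarrow> \<phi> (r j) = t j"
    by metis
  then have rG: "r \<in> J \<rightarrow> carrier G" by blast
  have "eval_word G (\<lambda>g. g) r (u i) \<in> N" if i: "i \<in> I" for i
  proof -
    have "\<phi> (eval_word G (\<lambda>g. g) r (u i)) = eval_word Q \<phi> t (u i)"
      unfolding eval[OF rG u[OF i], symmetric]
      by (rule eval_word_subst_cong[OF u[OF i]]) (rule r)
    then have "N #> eval_word G (\<lambda>g. g) r (u i) = N"
      using t(2)[OF i] by (simp add: \<phi>_def Q_def)
    then show ?thesis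
      using eval_word_closed[OF G G id rG u[OF i]] rcos_self[OF _ N.subgroup_axioms] by blast
  qed
  with rG show ?case unfolding N_def by blast
qed

theorem theorem2:
  fixes G :: "('a, 'b) monoid_scheme"
    and J :: "'j set"
    and I :: "'i set"
    and w :: "'i \<Rightarrow> ('a, 'j) word set"
  assumes "group G"
    and "nilpotent_group G"
    and "bounded_period G"
    and "equation_system G J I w"
    and "unimodular J I w"
  shows "solvable_in_itself G J I w"
proof -
  have "\<exists>u. u \<in> words G J \<and> w i = word_class G J u" if "i \<in> I" for i
  proof -
    have "w i \<in> carrier (free_prod G J)" using assms(4) that by (simp add: equation_system_def)
    then show ?thesis by (elim free_prod_cases) blast
  qed
  then obtain u where u: "\<And>i. i \<in> I \<Longrightarrow> u i \<in> words G J"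
    and w: "\<And>i. i \<in> I \<Longrightarrow> w i = word_class G J (u i)"
    by metis
  let ?a = "\<lambda>i j. word_exponent_sum j (u i)"
  obtain n :: nat where n: "n \<noteq> 0" "\<And>g. g \<in> carrier G \<Longrightarrow> g [^]\<^bsub>G\<^esub> n = \<one>\<^bsub>G\<^esub>"
    using assms(3) unfolding bounded_period_def by (metis not_one_le_zero)
  obtain c where c: "lower_central G c = {\<one>\<^bsub>G\<^esub>}"
    using assms(2) by (auto simp: nilpotent_group_def)
  have a: "exponent_sum j (w i) = ?a i j" if "i \<in> I" for i j
    using that by (simp add: w u exponent_sum_word_class)
  have "independent_off p I ?a {}" if "prime p" for p
  proof -
    have ind: "\<forall>S c. finite S \<and> S \<subseteq> I \<and>
        (\<forall>j\<in>J. [(\<Sum>i\<in>S. c i * exponent_sum j (w i)) = 0] (mod int p)) \<longrightarrow>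
        (\<forall>i\<in>S. [c i = 0] (mod int p))"
      using assms(5) that p_nonsingular_iff_cong[OF that, of J I w] by (simp add: unimodular_def)
    show ?thesis
      unfolding independent_off_def
    proof (intro allI impI, elim conjE)
      fix S c assume S: "finite S" "S \<subseteq> I"
        and c: "\<forall>j. j \<notin> {} \<longrightarrow> int p dvd (\<Sum>i\<in>S. c i * ?a i j)"
      have "(\<Sum>i\<in>S. c i * exponent_sum j (w i)) = (\<Sum>i\<in>S. c i * ?a i j)" for j
        using S by (intro sum.cong) (auto simp: a)
      with c have "\<forall>j\<in>J. [(\<Sum>i\<in>S. c i * exponent_sum j (w i)) = 0] (mod int p)"
        by (simp add: cong_0_iff)
      with ind S have "\<forall>i\<in>S. [c i = 0] (mod int p)" by blast
      then show "\<forall>i\<in>S. int p dvd c i" by (simp add: cong_0_iff)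
    qed
  qed
  moreover have "finite {j. ?a i j \<noteq> 0}" for i
    using word_exponent_sum_support finite_word_vars by (rule finite_subset)
  ultimately obtain C where "right_inverse_mod n I ?a C"
    using right_inverse_mod_exists[of I ?a n] n(1) by blast
  from solve_modulo_lower_central[OF assms(1) n(2) u this, of c]
  have "\<exists>s \<in> J \<rightarrow> carrier G. \<forall>i\<in>I. eval_word G (\<lambda>g. g) s (u i) = \<one>\<^bsub>G\<^esub>"
    by (simp add: c)
  then have "solvable_in_itself G J I (\<lambda>i. word_class G J (u i))"
    using solvable_in_itself_iff[where u = u and I = I and J = J, OF assms(1) u] by simp
  then show ?thesis by (simp add: solvable_in_itself_def w)
qed

end
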